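(* Let $m\ge2$, $s\ge1$, let $X_1,\dots,X_m\in\mathbb{Z}^s$ span $\mathbb{R}^s$ and be $\eta$-coplanar for some $\eta\in\mathbb{R}^s$, i.e. $\langle\eta,X_j\rangle=1$ for all $j$. Let $Z(t)=\sum_{j=1}^me^{\langle t,X_j\rangle}$ for $t\in\mathbb{R}^s$ and let $\gamma$ be the directional growth function (see context). Then for every unit vector $\theta$ in the interior of $\mathbf{C}_X=X_1\mathbb{R}^++\dots+X_m\mathbb{R}^+$, $$\gamma(\theta)=\langle\theta,\eta\rangle\log Z(t)-\langle t,\theta\rangle$$ for any $t\in\mathbb{R}^s$ satisfying $\nabla Z(t)/Z(t)=\theta/\langle\theta,\eta\rangle$.
   Context: $\mathcal{J}=X_1\mathbb{N}+\dots+X_m\mathbb{N}$ ($\mathbb{N}=\{0,1,\dots\}$). For $z\in\mathcal{J}$, $\mathbf{m}(z)$ is the number of finite words $i_1\cdots i_n$ ($i_k\in\{1,\dots,m\}$) with $X_{i_1}+\dots+X_{i_n}=z$; for $x\in\mathbf{C}_X$, $\mathbf{m}(x)=\min\{\mathbf{m}(z):z\in\mathcal{J},\ \|x-z\|=d(x,\mathcal{J})\}$ (Euclidean norm). The directional growth function is $\gamma(\theta)=\lim_{k\to\infty}\frac{\log\mathbf{m}(k\theta)}{k}$ for unit $\theta\in\mathbf{C}_X$ (this limit exists). *)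

theory Defs
  imports "HOL-Analysis.Analysis"
begin

text \<open>
  A family \<open>X\<^sub>1, \<dots>, X\<^sub>m\<close> is given by \<open>X :: nat \<Rightarrow> real ^ 's\<close> restricted to the indices \<open>{1..m}\<close>.
\<close>

definition coplanar_wrt :: "real ^ 's \<Rightarrow> nat \<Rightarrow> (nat \<Rightarrow> real ^ 's) \<Rightarrow> bool" where
  "coplanar_wrt \<eta> m X \<longleftrightarrow> (\<forall>j\<in>{1..m}. \<eta> \<bullet> X j = 1)"

definition monoid_J :: "nat \<Rightarrow> (nat \<Rightarrow> real ^ 's) \<Rightarrow> (real ^ 's) set" where
  "monoid_J m X = {\<Sum>j=1..m. real (n j) *\<^sub>R X j | n :: nat \<Rightarrow> nat. True}"

definition cone_C :: "nat \<Rightarrow> (nat \<Rightarrow> real ^ 's) \<Rightarrow> (real ^ 's) set" where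
  "cone_C m X = {\<Sum>j=1..m. c j *\<^sub>R X j | c :: nat \<Rightarrow> real. \<forall>j\<in>{1..m}. 0 \<le> c j}"

text \<open>
  The set of words is finite whenever the family is coplanar with respect to some \<open>\<eta>\<close>,
  since then every such word has length \<open>\<eta> \<bullet> z\<close>.
\<close>

definition word_mult :: "nat \<Rightarrow> (nat \<Rightarrow> real ^ 's) \<Rightarrow> real ^ 's \<Rightarrow> nat" where
  "word_mult m X z = card {w :: nat list. set w \<subseteq> {1..m} \<and> sum_list (map X w) = z}"

text \<open>
  For integer vectors the set of nearest points of \<open>monoid_J m X\<close> is finite and nonempty,
  so \<open>Min\<close> is a genuine minimum.
\<close>

definition near_mult :: "nat \<Rightarrow> (nat \<Rightarrow> real ^ 's) \<Rightarrow> real ^ 's \<Rightarrow> nat" where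
  "near_mult m X x =
     Min {word_mult m X z | z. z \<in> monoid_J m X \<and> norm (x - z) = infdist x (monoid_J m X)}"

definition growth_seq :: "nat \<Rightarrow> (nat \<Rightarrow> real ^ 's) \<Rightarrow> real ^ 's \<Rightarrow> nat \<Rightarrow> real" where
  "growth_seq m X \<theta> k = ln (real (near_mult m X (real k *\<^sub>R \<theta>))) / real k"

definition dir_growth :: "nat \<Rightarrow> (nat \<Rightarrow> real ^ 's) \<Rightarrow> real ^ 's \<Rightarrow> real" where
  "dir_growth m X \<theta> = lim (growth_seq m X \<theta>)"

definition partition_Z :: "nat \<Rightarrow> (nat \<Rightarrow> real ^ 's) \<Rightarrow> real ^ 's \<Rightarrow> real" where
  "partition_Z m X t = (\<Sum>j=1..m. exp (t \<bullet> X j))"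

definition gradient :: "(real ^ 's \<Rightarrow> real) \<Rightarrow> real ^ 's \<Rightarrow> real ^ 's" where
  "gradient f x = (THE D. GDERIV f x :> D)"

lemma gradient_eqI:
  assumes "GDERIV f x :> D"
  shows "gradient f x = D"
  unfolding gradient_def
proof (rule the_equality)
  show "GDERIV f x :> D" by (fact assms)
next
  fix D' assume "GDERIV f x :> D'"
  then have "(\<lambda>h. h \<bullet> D') = (\<lambda>h. h \<bullet> D)"
    using assms unfolding gderiv_def by (rule has_derivative_unique)
  then have "(D' - D) \<bullet> D' = (D' - D) \<bullet> D"
    by (rule fun_cong)
  then have "(D' - D) \<bullet> (D' - D) = 0"
    by (simp only: inner_diff_right)
  then show "D' = D"
    by simp
qed

lemma GDERIV_partition_Z:
  "GDERIV (partition_Z m X) t :> (\<Sum>j=1..m. exp (t \<bullet> X j) *\<^sub>R X j)"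
proof -
  have *: "((\<lambda>t. exp (t \<bullet> X j)) has_derivative (\<lambda>h. exp (t \<bullet> X j) * (h \<bullet> X j))) (at t)" for j
    by (rule has_derivative_eq_rhs, (rule derivative_intros)+, simp add: mult.commute)
  have "((\<lambda>t. \<Sum>j=1..m. exp (t \<bullet> X j)) has_derivative
      (\<lambda>h. \<Sum>j=1..m. exp (t \<bullet> X j) * (h \<bullet> X j))) (at t)"
    by (rule has_derivative_sum) (rule *)
  moreover have "partition_Z m X = (\<lambda>t. \<Sum>j=1..m. exp (t \<bullet> X j))"
    by (rule ext) (rule partition_Z_def)
  ultimately show ?thesis
    by (simp add: gderiv_def inner_sum_right)
qed

lemma gradient_partition_Z:
  "gradient (partition_Z m X) t = (\<Sum>j=1..m. exp (t \<bullet> X j) *\<^sub>R X j)"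
  by (rule gradient_eqI[OF GDERIV_partition_Z])

end

theory Submission imports Defs "HOL-Combinatorics.Multiset_Permutations" begin

text \<open>
  With \<open>h = \<langle>\<theta>, \<eta>\<rangle>\<close> and \<open>p\<^sub>j = exp \<langle>t, X\<^sub>j\<rangle> / Z(t)\<close>, the condition on \<open>t\<close> says that \<open>\<theta> = \<Sum>\<^sub>j h p\<^sub>j X\<^sub>j\<close>.
  Let \<open>z\<close> be a point of the monoid nearest to \<open>k \<theta>\<close>; its distance to \<open>k \<theta>\<close> is bounded independently of \<open>k\<close>.
  All words with sum \<open>z\<close> have length \<open>n = \<langle>\<eta>, z\<rangle>\<close>, and expanding \<open>Z(t)^n\<close> over words of length \<open>n\<close> bounds
  their number by \<open>Z(t)^n exp (- \<langle>t, z\<rangle>)\<close>.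
  For the lower bound, write \<open>z = \<Sum>\<^sub>j n\<^sub>j X\<^sub>j\<close> with \<open>n\<^sub>j = k h p\<^sub>j + O(1)\<close>: the difference between \<open>z\<close> and
  \<open>\<Sum>\<^sub>j \<lfloor>k h p\<^sub>j\<rfloor> X\<^sub>j\<close> is one of finitely many bounded vectors of the lattice generated by the \<open>X\<^sub>j\<close>, so its
  integer coefficients can be chosen bounded. The multinomial coefficient of \<open>(n\<^sub>j)\<close> then has
  exponential growth rate \<open>- h \<Sum>\<^sub>j p\<^sub>j ln p\<^sub>j = h ln Z(t) - \<langle>t, \<theta>\<rangle>\<close>, which matches the upper bound.
\<close>

section \<open>Bounded integer vectors and expansion of powers over words\<close>

lemma finite_bounded_Ints: "finite {x::real. x \<in> \<int> \<and> \<bar>x\<bar> \<le> R}"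
proof (rule finite_subset)
  show "{x::real. x \<in> \<int> \<and> \<bar>x\<bar> \<le> R} \<subseteq> of_int ` {-\<lceil>R\<rceil>..\<lceil>R\<rceil>}"
  proof
    fix x :: real assume x: "x \<in> {x. x \<in> \<int> \<and> \<bar>x\<bar> \<le> R}"
    then obtain i where i: "x = of_int i" by (auto elim: Ints_cases)
    have "of_int i \<le> R" "- of_int i \<le> R" using x i by auto
    then have "i \<in> {-\<lceil>R\<rceil>..\<lceil>R\<rceil>}" by (simp add: minus_le_iff) linarith
    then show "x \<in> of_int ` {-\<lceil>R\<rceil>..\<lceil>R\<rceil>}" using i by blast
  qed
qed simp

lemma finite_bounded_int_vectors:
  "finite {x :: real ^ 's. (\<forall>i. x $ i \<in> \<int>) \<and> norm x \<le> R}"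
proof (rule finite_subset)
  let ?Z = "{x::real. x \<in> \<int> \<and> \<bar>x\<bar> \<le> R}"
  show "{x :: real ^ 's. (\<forall>i. x $ i \<in> \<int>) \<and> norm x \<le> R} \<subseteq> vec_lambda ` (PiE UNIV (\<lambda>_::'s. ?Z))"
  proof
    fix x :: "real ^ 's" assume "x \<in> {x. (\<forall>i. x $ i \<in> \<int>) \<and> norm x \<le> R}"
    then have "vec_nth x \<in> PiE UNIV (\<lambda>_::'s. ?Z)"
      by (auto intro: order_trans[OF component_le_norm_cart])
    then show "x \<in> vec_lambda ` (PiE UNIV (\<lambda>_::'s. ?Z))"
      by (intro image_eqI[of _ _ "vec_nth x"]) simp_all
  qed
  show "finite (vec_lambda ` (PiE UNIV (\<lambda>_::'s. ?Z)))"
    by (intro finite_imageI finite_PiE finite finite_bounded_Ints)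
qed

text \<open>Expanding the power picks one summand from each factor; the induction splits off the
  first letter. With \<open>f j = exp (t \<bullet> X j)\<close> this turns
  \<open>partition_Z m X t ^ n\<close> into a sum over words.\<close>

lemma sum_prod_list_lists_length:
  fixes f :: "'a \<Rightarrow> 'b::comm_semiring_1"
  assumes "finite A"
  shows "(\<Sum>w | set w \<subseteq> A \<and> length w = n. prod_list (map f w)) = (\<Sum>a\<in>A. f a) ^ n"
proof (induction n)
  case 0
  have "{w. set w \<subseteq> A \<and> length w = 0} = {[]}" by auto
  then show ?case by simp
next
  case (Suc n)
  let ?L = "{w. set w \<subseteq> A \<and> length w = n}"
  have "(\<Sum>w | set w \<subseteq> A \<and> length w = Suc n. prod_list (map f w))
      = (\<Sum>(w, a)\<in>?L \<times> A. f a * prod_list (map f w))"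
    unfolding lists_length_Suc_eq
    by (subst sum.reindex) (auto simp: inj_on_def case_prod_unfold)
  also have "\<dots> = (\<Sum>w\<in>?L. prod_list (map f w)) * (\<Sum>a\<in>A. f a)"
    unfolding sum_product sum.cartesian_product[symmetric] by (simp only: mult.commute)
  finally show ?case using Suc by (simp add: mult.commute)
qed

section \<open>Growth of factorials and multinomial coefficients\<close>

text \<open>Stirling's formula up to an error of \<open>ln n + 1\<close>, which is negligible after
  division by \<open>n\<close>. The induction rests on
  \<open>1 / (n + 1) \<le> ln (n + 1) - ln n \<le> 1 / n\<close>.\<close>

lemma ln_fact_bounds:
  assumes "n > 0"
  shows "real n * ln n - n \<le> ln (fact n)" "ln (fact n) \<le> real n * ln n - n + ln n + 1"
  using assms
proof (induction n rule: nat_induct_non_zero)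
  case (Suc n)
  have q: "ln (real (Suc n)) - ln n = ln (1 + 1 / n)"
  proof -
    have "1 + 1 / real n = real (Suc n) / real n" using Suc.hyps by (simp add: field_simps)
    then show ?thesis using Suc.hyps by (simp add: ln_div)
  qed
  have "ln (1 + 1 / real n) \<le> 1 / n" by (rule ln_add_one_self_le_self) simp
  then have up: "real n * (ln (real (Suc n)) - ln n) \<le> 1"
    unfolding q using Suc.hyps by (simp add: field_simps)
  have "ln (real n / Suc n) \<le> real n / Suc n - 1" using Suc.hyps by (intro ln_le_minus_one) simp
  then have "1 / Suc n \<le> ln (real (Suc n)) - ln n"
    using Suc.hyps by (simp add: ln_div field_simps)
  then have lo: "1 \<le> real (Suc n) * (ln (real (Suc n)) - ln n)"
    by (simp add: field_simps)
  have f: "ln (fact (Suc n)) = ln (real (Suc n)) + ln (fact n)"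
    by (simp add: ln_mult del: of_nat_Suc)
  {
    case 1
    then show ?case using Suc.IH(1) up unfolding f by (simp add: algebra_simps)
  next
    case 2
    then show ?case using Suc.IH(2) lo unfolding f by (simp add: algebra_simps)
  }
qed simp_all

lemma ln_fact_asymp: "(\<lambda>n. ln (fact n) / real n - ln n) \<longlonglongrightarrow> -1"
proof (rule tendsto_sandwich)
  show "\<forall>\<^sub>F n in sequentially. -1 \<le> ln (fact n) / real n - ln n"
    using eventually_gt_at_top[of 0]
  proof eventually_elim
    case (elim n)
    then show ?case
      using divide_right_mono[OF ln_fact_bounds(1)[OF elim], of "real n"] by (simp add: diff_divide_distrib)
  qed
  show "\<forall>\<^sub>F n in sequentially. ln (fact n) / real n - ln n \<le> -1 + (ln (real n) + 1) / n"
    using eventually_gt_at_top[of 0]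
  proof eventually_elim
    case (elim n)
    then show ?case
      using divide_right_mono[OF ln_fact_bounds(2)[OF elim], of "real n"]
      by (simp add: diff_divide_distrib add_divide_distrib)
  qed
  show "(\<lambda>n. -1 + (ln (real n) + 1) / n) \<longlonglongrightarrow> -1"
    using tendsto_add[OF tendsto_const[of "-1"] tendsto_add[OF lim_ln_over_n lim_1_over_n]]
    by (simp add: add_divide_distrib)
qed simp

text \<open>Subtracting \<open>u k * ln k\<close> removes the superlinear part of
  \<open>ln (fact (u k))\<close>: write \<open>ln (u k) = ln (u k / k) + ln k\<close> and apply
  \<open>ln_fact_asymp\<close> along \<open>u k\<close>, which tends to infinity.\<close>

lemma ln_fact_linear_asymp:
  fixes u :: "nat \<Rightarrow> nat"
  assumes lim: "(\<lambda>k. real (u k) / k) \<longlonglongrightarrow> r" and r: "r > 0"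
  shows "(\<lambda>k. (ln (fact (u k)) - u k * ln k) / k) \<longlonglongrightarrow> r * ln r - r"
proof -
  have "filterlim (\<lambda>k. real (u k) / k * real k) at_top sequentially"
    by (rule filterlim_tendsto_pos_mult_at_top[OF lim r filterlim_real_sequentially])
  then have "filterlim (\<lambda>k. real (u k)) at_top sequentially"
    by (rule filterlim_mono_eventually)
       (simp_all add: eventually_mono[OF eventually_gt_at_top[of 0]])
  then have u: "filterlim u at_top sequentially"
    by (simp add: filterlim_sequentially_iff_filterlim_real)
  have "(\<lambda>k. real (u k) / k * ((ln (fact (u k)) / real (u k) - ln (u k)) + ln (real (u k) / k)))
      \<longlonglongrightarrow> r * (-1 + ln r)"
    using r by (intro tendsto_intros lim filterlim_compose[OF ln_fact_asymp u]) auto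
  moreover have "\<forall>\<^sub>F k in sequentially.
      real (u k) / k * ((ln (fact (u k)) / real (u k) - ln (u k)) + ln (real (u k) / k))
      = (ln (fact (u k)) - u k * ln k) / k"
  proof -
    have "\<forall>\<^sub>F k in sequentially. u k > 0" 
      using u eventually_gt_at_top[of 0] by (rule eventually_compose_filterlim[rotated])
    then show ?thesis using eventually_gt_at_top[of 0]
      by eventually_elim (auto simp: ln_div field_simps)
  qed
  ultimately have "(\<lambda>k. (ln (fact (u k)) - u k * ln k) / k) \<longlonglongrightarrow> r * (-1 + ln r)"
    by (rule Lim_transform_eventually)
  then show ?thesis by (simp add: algebra_simps)
qed

text \<open>The terms \<open>u j k * ln k\<close> of the denominator cancel the one of the
  numerator, and so do the linear terms \<open>r j\<close>. What remains is the entropy of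
  \<open>r\<close>, not normalised to total mass 1.\<close>

lemma ln_multinomial_asymp:
  fixes u :: "'a \<Rightarrow> nat \<Rightarrow> nat"
  assumes "finite I" "I \<noteq> {}"
    and lim: "\<And>j. j \<in> I \<Longrightarrow> (\<lambda>k. real (u j k) / k) \<longlonglongrightarrow> r j"
    and pos: "\<And>j. j \<in> I \<Longrightarrow> r j > 0"
  shows "(\<lambda>k. ln (fact (\<Sum>j\<in>I. u j k) / (\<Prod>j\<in>I. fact (u j k))) / k)
    \<longlonglongrightarrow> (\<Sum>j\<in>I. r j) * ln (\<Sum>j\<in>I. r j) - (\<Sum>j\<in>I. r j * ln (r j))"
proof -
  let ?U = "\<lambda>k. \<Sum>j\<in>I. u j k" and ?R = "\<Sum>j\<in>I. r j"
  have "(\<lambda>k. \<Sum>j\<in>I. real (u j k) / k) \<longlonglongrightarrow> ?R" by (intro tendsto_sum lim)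
  then have "(\<lambda>k. real (?U k) / k) \<longlonglongrightarrow> ?R" by (simp add: sum_divide_distrib)
  moreover have "?R > 0" using assms by (intro sum_pos) auto
  ultimately have "(\<lambda>k. (ln (fact (?U k)) - ?U k * ln k) / k
        - (\<Sum>j\<in>I. (ln (fact (u j k)) - u j k * ln k) / k))
      \<longlonglongrightarrow> (?R * ln ?R - ?R) - (\<Sum>j\<in>I. r j * ln (r j) - r j)"
    by (intro tendsto_diff tendsto_sum ln_fact_linear_asymp lim pos) auto
  moreover have "(ln (fact (?U k)) - ?U k * ln k) / k
        - (\<Sum>j\<in>I. (ln (fact (u j k)) - u j k * ln k) / k)
      = ln (fact (?U k) / (\<Prod>j\<in>I. fact (u j k))) / k" for k
  proof -
    have "ln (fact (?U k) / (\<Prod>j\<in>I. fact (u j k)) :: real) =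
        ln (fact (?U k)) - (\<Sum>j\<in>I. ln (fact (u j k)))"
      using \<open>finite I\<close> by (simp add: ln_div prod_pos ln_prod)
    then show ?thesis
      by (simp add: sum_divide_distrib[symmetric] sum_subtractf sum_distrib_right diff_divide_distrib)
  qed
  ultimately show ?thesis by (simp add: sum_subtractf)
qed

section \<open>Bounds for the number of words with a given sum\<close>

lemma inner_word_sum:
  fixes X :: "nat \<Rightarrow> real ^ 's"
  assumes "coplanar_wrt \<eta> m X" "set w \<subseteq> {1..m}"
  shows "\<eta> \<bullet> sum_list (map X w) = length w"
  using assms(2) by (induction w) (use assms(1) in \<open>auto simp: coplanar_wrt_def inner_add_right\<close>)

lemma prod_list_exp_inner:
  "prod_list (map (\<lambda>j. exp (t \<bullet> X j)) w) = exp (t \<bullet> sum_list (map X w))"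
  by (induction w) (simp_all add: inner_add_right exp_add)

text \<open>Coplanarity fixes the length of such words. Finiteness allows \<open>card\<close> in
  \<open>word_mult\<close> to be bounded below by the size of a subset.\<close>

lemma finite_words:
  fixes X :: "nat \<Rightarrow> real ^ 's"
  assumes "coplanar_wrt \<eta> m X"
  shows "finite {w. set w \<subseteq> {1..m} \<and> sum_list (map X w) = z}"
proof (rule finite_subset)
  show "{w. set w \<subseteq> {1..m} \<and> sum_list (map X w) = z} \<subseteq>
      {w. set w \<subseteq> {1..m} \<and> length w = nat \<lfloor>\<eta> \<bullet> z\<rfloor>}"
    using inner_word_sum[OF assms] by fastforce
qed (simp add: finite_lists_length_eq)

text \<open>Every word with sum \<open>z\<close> has length \<open>n\<close> and contributes exactly
  \<open>exp (t \<bullet> z)\<close> to the expansion of the power; the other words contribute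
  positive terms.\<close>

lemma word_mult_le:
  fixes X :: "nat \<Rightarrow> real ^ 's"
  assumes "coplanar_wrt \<eta> m X" "\<eta> \<bullet> z = real n"
  shows "word_mult m X z * exp (t \<bullet> z) \<le> partition_Z m X t ^ n"
proof -
  let ?W = "{w. set w \<subseteq> {1..m} \<and> sum_list (map X w) = z}"
  have "word_mult m X z * exp (t \<bullet> z) = (\<Sum>w\<in>?W. prod_list (map (\<lambda>j. exp (t \<bullet> X j)) w))"
    by (simp add: word_mult_def prod_list_exp_inner)
  also have "\<dots> \<le> (\<Sum>w | set w \<subseteq> {1..m} \<and> length w = n. prod_list (map (\<lambda>j. exp (t \<bullet> X j)) w))"
    using inner_word_sum[OF assms(1)] assms(2)
    by (intro sum_mono2) (auto simp: finite_lists_length_eq prod_list_exp_inner)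
  also have "\<dots> = partition_Z m X t ^ n"
    by (simp add: sum_prod_list_lists_length partition_Z_def)
  finally show ?thesis .
qed

text \<open>Every arrangement of \<open>n j\<close> copies of each letter \<open>j\<close> is a word
  with the required sum. Other coefficient vectors may give the same sum, so equality can
  fail.\<close>

lemma multinomial_le_word_mult:
  fixes X :: "nat \<Rightarrow> real ^ 's"
  assumes "coplanar_wrt \<eta> m X"
  shows "fact (\<Sum>j=1..m. n j) / (\<Prod>j=1..m. fact (n j))
    \<le> real (word_mult m X (\<Sum>j=1..m. real (n j) *\<^sub>R X j))"
proof -
  define M where "M = (\<Sum>j=1..m. replicate_mset (n j) j)"
  have cnt: "count M j = (if j \<in> {1..m} then n j else 0)" for j
  proof -
    have "count M j = (\<Sum>i=1..m. if i = j then n i else 0)"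
      unfolding M_def count_sum by (intro sum.cong) auto
    then show ?thesis by simp
  qed
  have set: "set_mset M \<subseteq> {1..m}"
    by (metis cnt count_greater_zero_iff less_irrefl subsetI)
  have size: "size M = (\<Sum>j=1..m. n j)" by (simp add: M_def)
  \<comment> \<open>Letters with \<open>n j = 0\<close> are missing from \<open>set_mset M\<close>,
    but only contribute the factor \<open>fact 0 = 1\<close>.\<close>
  have "(\<Prod>j\<in>set_mset M. fact (count M j)) = (\<Prod>j=1..m. fact (n j) :: nat)"
    using set by (intro prod.mono_neutral_cong_left) (auto simp: cnt not_in_iff)
  then have "card (permutations_of_multiset M) * (\<Prod>j=1..m. fact (n j)) = fact (\<Sum>j=1..m. n j)"
    using card_permutations_of_multiset_aux[of M] size by simp
  then have "fact (\<Sum>j=1..m. n j) = real (card (permutations_of_multiset M)) * (\<Prod>j=1..m. fact (n j))"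
    by (metis (mono_tags, lifting) of_nat_fact of_nat_mult of_nat_prod prod.cong)
  then have "fact (\<Sum>j=1..m. n j) / (\<Prod>j=1..m. fact (n j)) = real (card (permutations_of_multiset M))"
    by (simp add: prod_zero_iff)
  also have "card (permutations_of_multiset M) \<le> word_mult m X (\<Sum>j=1..m. real (n j) *\<^sub>R X j)"
    unfolding word_mult_def
  proof (rule card_mono[OF finite_words[OF assms]], rule subsetI)
    fix w assume "w \<in> permutations_of_multiset M"
    then have w: "mset w = M" by (rule permutations_of_multisetD)
    then have "set w \<subseteq> {1..m}" using set by (metis set_mset_mset)
    moreover have "sum_list (map X w) = (\<Sum>j=1..m. real (n j) *\<^sub>R X j)"
    proof -
      have "sum_list (map X w) = \<Sum>\<^sub># (image_mset X M)"
        by (simp add: w[symmetric] sum_mset_sum_list[symmetric])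
      also have "\<dots> = (\<Sum>j=1..m. real (n j) *\<^sub>R X j)"
      proof -
        have rep: "\<Sum>\<^sub># (image_mset X (replicate_mset k j)) = real k *\<^sub>R X j" for k j
          by (induction k) (simp_all add: scaleR_add_left)
        have "\<Sum>\<^sub># (image_mset X (\<Sum>j\<in>I. replicate_mset (n j) j)) = (\<Sum>j\<in>I. real (n j) *\<^sub>R X j)"
          if "finite I" for I
          using that by (induction I rule: finite_induct) (simp_all add: rep del: image_replicate_mset)
        then show ?thesis by (simp add: M_def)
      qed
      finally show ?thesis .
    qed
    ultimately show "w \<in> {w. set w \<subseteq> {1..m} \<and> sum_list (map X w) = (\<Sum>j=1..m. real (n j) *\<^sub>R X j)}"
      by simp
  qed
  finally show ?thesis by simp
qed

section \<open>Nearest points and integer coefficients\<close>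

lemma int_combination_Ints:
  fixes X :: "nat \<Rightarrow> real ^ 's"
  assumes "\<forall>j\<in>{1..m}. \<forall>i. X j $ i \<in> \<int>"
  shows "(\<Sum>j=1..m. of_int (a j) *\<^sub>R X j) $ i \<in> \<int>"
  using assms by (auto intro!: Ints_sum Ints_mult)

lemma monoid_J_int_combination:
  assumes "z \<in> monoid_J m X"
  obtains n :: "nat \<Rightarrow> nat" where "z = (\<Sum>j=1..m. of_int (int (n j)) *\<^sub>R X j)"
  using assms by (auto simp: monoid_J_def)

lemma monoid_J_inner_nat:
  assumes "coplanar_wrt \<eta> m X" "z \<in> monoid_J m X"
  obtains n :: nat where "\<eta> \<bullet> z = real n"
proof -
  obtain n where "z = (\<Sum>j=1..m. real (n j) *\<^sub>R X j)" using assms(2) by (auto simp: monoid_J_def)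
  then have "\<eta> \<bullet> z = real (\<Sum>j=1..m. n j)"
    using assms(1) by (simp add: inner_sum_right coplanar_wrt_def)
  then show ?thesis by (rule that)
qed

lemma finite_monoid_J_cball:
  fixes X :: "nat \<Rightarrow> real ^ 's"
  assumes "\<forall>j\<in>{1..m}. \<forall>i. X j $ i \<in> \<int>"
  shows "finite (monoid_J m X \<inter> cball x r)"
proof (rule finite_subset[OF _ finite_bounded_int_vectors])
  show "monoid_J m X \<inter> cball x r \<subseteq> {z. (\<forall>i. z $ i \<in> \<int>) \<and> norm z \<le> norm x + r}"
  proof
    fix z assume z: "z \<in> monoid_J m X \<inter> cball x r"
    obtain n :: "nat \<Rightarrow> nat" where "z = (\<Sum>j=1..m. of_int (int (n j)) *\<^sub>R X j)"
      using z monoid_J_int_combination by blast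
    then have "\<forall>i. z $ i \<in> \<int>" using int_combination_Ints[OF assms] by (simp only:) blast
    moreover have "norm z \<le> norm x + r"
      using z norm_triangle_ineq2[of z x] by (auto simp: dist_norm norm_minus_commute)
    ultimately show "z \<in> {z. (\<forall>i. z $ i \<in> \<int>) \<and> norm z \<le> norm x + r}" by simp
  qed
qed

text \<open>Integrality makes the monoid locally finite. Hence it is closed, the distance is
  attained, and only at finitely many points, so \<open>Min\<close> is taken over a finite nonempty
  set.\<close>

lemma near_mult_attained:
  fixes X :: "nat \<Rightarrow> real ^ 's"
  assumes int: "\<forall>j\<in>{1..m}. \<forall>i. X j $ i \<in> \<int>"
  obtains z where "z \<in> monoid_J m X" "norm (x - z) = infdist x (monoid_J m X)"
    "near_mult m X x = word_mult m X z"
proof -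
  let ?J = "monoid_J m X"
  let ?N = "{z. z \<in> ?J \<and> norm (x - z) = infdist x ?J}"
  have "\<not> y islimpt ?J" for y
    using finite_monoid_J_cball[OF int, of y 1] zero_less_one islimpt_eq_infinite_cball by blast
  then have "closed ?J" by (auto simp: closed_limpt)
  moreover have "?J \<noteq> {}" by (auto simp: monoid_J_def)
  ultimately obtain z0 where "z0 \<in> ?J" "infdist x ?J = dist x z0"
    using infdist_attains_inf by blast
  then have "?N \<noteq> {}" by (auto simp: dist_norm)
  moreover have "finite ?N"
    by (rule finite_subset[OF _ finite_monoid_J_cball[OF int, of x "infdist x ?J"]])
       (auto simp: dist_norm)
  ultimately have "Min (word_mult m X ` ?N) \<in> word_mult m X ` ?N" by (intro Min_in) auto
  moreover have "near_mult m X x = Min (word_mult m X ` ?N)"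
    unfolding near_mult_def by (rule arg_cong[of _ _ Min]) blast
  ultimately obtain z where "z \<in> ?N" "near_mult m X x = word_mult m X z" by auto
  then show thesis using that by blast
qed

lemma norm_floor_combination:
  fixes X :: "nat \<Rightarrow> 'a::real_normed_vector"
  shows "norm ((\<Sum>j=1..m. c j *\<^sub>R X j) - (\<Sum>j=1..m. of_int \<lfloor>c j\<rfloor> *\<^sub>R X j)) \<le> (\<Sum>j=1..m. norm (X j))"
proof -
  have "(\<Sum>j=1..m. c j *\<^sub>R X j) - (\<Sum>j=1..m. of_int \<lfloor>c j\<rfloor> *\<^sub>R X j) = (\<Sum>j=1..m. (c j - of_int \<lfloor>c j\<rfloor>) *\<^sub>R X j)"
    by (simp add: sum_subtractf scaleR_diff_left)
  also have "norm \<dots> \<le> (\<Sum>j=1..m. norm (X j))"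
  proof (rule sum_norm_le)
    fix j
    have "\<bar>c j - of_int \<lfloor>c j\<rfloor>\<bar> \<le> 1" by linarith
    then show "norm ((c j - of_int \<lfloor>c j\<rfloor>) *\<^sub>R X j) \<le> norm (X j)"
      by (simp add: mult_left_le_one_le)
  qed
  finally show ?thesis .
qed

text \<open>Rounding down moves the point by at most \<open>norm (X j)\<close> per generator, and
  nonnegativity keeps the rounded coefficients natural. The bound is independent of
  \<open>c\<close>, hence uniform along a ray.\<close>

lemma infdist_monoid_J_le:
  assumes "\<And>j. j \<in> {1..m} \<Longrightarrow> 0 \<le> c j"
  shows "infdist (\<Sum>j=1..m. c j *\<^sub>R X j) (monoid_J m X) \<le> (\<Sum>j=1..m. norm (X j))"
proof -
  have "(\<Sum>j=1..m. of_int \<lfloor>c j\<rfloor> *\<^sub>R X j) = (\<Sum>j=1..m. real (nat \<lfloor>c j\<rfloor>) *\<^sub>R X j)"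
    using assms by (intro sum.cong) auto
  then have "(\<Sum>j=1..m. of_int \<lfloor>c j\<rfloor> *\<^sub>R X j) \<in> monoid_J m X"
    unfolding monoid_J_def by fastforce
  then show ?thesis
    by (rule order_trans[OF infdist_le]) (simp only: dist_norm norm_floor_combination)
qed

text \<open>Linear relations among the \<open>X j\<close> let a short vector have arbitrarily large
  coefficients \<open>b\<close>. Only finitely many integer vectors have norm at most
  \<open>R\<close>, so one representation of each is fixed and \<open>A\<close> bounds them
  all.\<close>

lemma bounded_int_coefficients:
  fixes X :: "nat \<Rightarrow> real ^ 's"
  assumes "\<forall>j\<in>{1..m}. \<forall>i. X j $ i \<in> \<int>"
  obtains A :: int where "\<And>b :: nat \<Rightarrow> int. norm (\<Sum>j=1..m. of_int (b j) *\<^sub>R X j) \<le> R \<Longrightarrow>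
    \<exists>a. (\<Sum>j=1..m. of_int (a j) *\<^sub>R X j) = (\<Sum>j=1..m. of_int (b j) *\<^sub>R X j) \<and> (\<forall>j\<in>{1..m}. \<bar>a j\<bar> \<le> A)"
proof -
  let ?s = "\<lambda>b :: nat \<Rightarrow> int. \<Sum>j=1..m. of_int (b j) *\<^sub>R X j"
  define Y where "Y = range ?s \<inter> {y. norm y \<le> R}"
  have "finite Y"
    by (rule finite_subset[OF _ finite_bounded_int_vectors[of R]])
       (use int_combination_Ints[OF assms] in \<open>auto simp: Y_def simp del: sum_component\<close>)
  moreover have "\<forall>y\<in>Y. \<exists>a. ?s a = y" by (auto simp: Y_def)
  ultimately obtain f where f: "\<And>y. y \<in> Y \<Longrightarrow> ?s (f y) = y" by metis
  \<comment> \<open>Inserting \<open>0\<close> keeps the set nonempty when \<open>m = 0\<close> or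
    \<open>R\<close> is negative.\<close>
  define A where "A = Max (insert 0 ((\<lambda>(y, j). \<bar>f y j\<bar>) ` (Y \<times> {1..m})))"
  have A: "\<bar>f y j\<bar> \<le> A" if "y \<in> Y" "j \<in> {1..m}" for y j
    unfolding A_def by (rule Max_ge) (use that \<open>finite Y\<close> in force)+
  show thesis
  proof (rule that[of A])
    fix b assume "norm (?s b) \<le> R"
    then have "?s b \<in> Y" by (auto simp: Y_def)
    then show "\<exists>a. ?s a = ?s b \<and> (\<forall>j\<in>{1..m}. \<bar>a j\<bar> \<le> A)" using f A by blast
  qed
qed

lemma tendsto_divide_of_bounded_diff:
  fixes u :: "nat \<Rightarrow> 'a::real_normed_vector"
  assumes "\<And>k. norm (u k - real k *\<^sub>R c) \<le> B"
  shows "(\<lambda>k. u k /\<^sub>R real k) \<longlonglongrightarrow> c"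
proof (rule LIM_zero_cancel, rule Lim_null_comparison)
  show "\<forall>\<^sub>F k in sequentially. norm (u k /\<^sub>R real k - c) \<le> B / real k"
    using eventually_gt_at_top[of 0]
  proof eventually_elim
    case (elim k)
    then have "u k /\<^sub>R real k - c = (u k - real k *\<^sub>R c) /\<^sub>R real k"
      by (simp add: scaleR_diff_right)
    then show ?case using assms[of k] elim by (simp add: divide_simps mult.commute)
  qed
  show "(\<lambda>k. B / real k) \<longlonglongrightarrow> 0" by (rule lim_const_over_n)
qed

theorem theorem6p2:
  fixes m :: nat and X :: "nat \<Rightarrow> real ^ 's" and \<eta> \<theta> t :: "real ^ 's"
  assumes "m \<ge> 2"
    and "\<forall>j\<in>{1..m}. \<forall>i. X j $ i \<in> \<int>"
    and "span (X ` {1..m}) = UNIV"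
    and "coplanar_wrt \<eta> m X"
    and "norm \<theta> = 1"
    and "\<theta> \<in> interior (cone_C m X)"
    and "gradient (partition_Z m X) t /\<^sub>R partition_Z m X t = \<theta> /\<^sub>R (\<theta> \<bullet> \<eta>)"
  shows "convergent (growth_seq m X \<theta>) \<and>
    dir_growth m X \<theta> = (\<theta> \<bullet> \<eta>) * ln (partition_Z m X t) - t \<bullet> \<theta>"
proof -

  \<comment> \<open>Letter frequencies and their entropy\<close>
  note int = assms(2) and cop = assms(4)
  define Z where "Z = partition_Z m X t"
  define h where "h = \<theta> \<bullet> \<eta>"
  \<comment> \<open>\<open>c j\<close> is the number of letters \<open>j\<close> per unit of
    \<open>k\<close>: total mass \<open>h\<close>, distributed according to the Gibbs weights
    \<open>exp (t \<bullet> X j) / Z\<close>.\<close>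
  define c where "c j = h * (exp (t \<bullet> X j) / Z)" for j
  have "Z > 0" unfolding Z_def partition_Z_def using assms(1) by (intro sum_pos) auto
  \<comment> \<open>By coplanarity \<open>h\<close> is the sum of the coefficients in any conic
    representation of \<theta>, so it vanishes only if \<theta> does.\<close>
  have "h > 0"
  proof -
    have "\<theta> \<in> cone_C m X" using assms(6) interior_subset by blast
    then obtain d where d: "\<theta> = (\<Sum>j=1..m. d j *\<^sub>R X j)" "\<forall>j\<in>{1..m}. 0 \<le> d j"
      by (auto simp: cone_C_def)
    have h: "h = (\<Sum>j=1..m. d j)"
      using cop unfolding h_def d(1) inner_sum_left
      by (intro sum.cong) (auto simp: coplanar_wrt_def inner_commute[of _ \<eta>])
    have "h \<noteq> 0"
    proof
      assume "h = 0"
      then have "\<forall>j\<in>{1..m}. d j = 0" using d(2) h sum_nonneg_eq_0_iff[of "{1..m}" d] by auto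
      then have "\<theta> = 0" by (simp add: d(1))
      then show False using assms(5) by simp
    qed
    moreover have "h \<ge> 0" unfolding h using d(2) by (intro sum_nonneg) auto
    ultimately show ?thesis by simp
  qed
  have c_pos: "c j > 0" for j using \<open>h > 0\<close> \<open>Z > 0\<close> by (simp add: c_def)
  have sum_c: "(\<Sum>j=1..m. c j) = h"
    using \<open>Z > 0\<close> by (simp add: c_def sum_distrib_left[symmetric] sum_divide_distrib[symmetric])
       (simp add: Z_def partition_Z_def)
  have \<theta>: "\<theta> = (\<Sum>j=1..m. c j *\<^sub>R X j)"
  proof -
    have "\<theta> = h *\<^sub>R (\<theta> /\<^sub>R h)" using \<open>h > 0\<close> by simp
    also have "\<dots> = h *\<^sub>R (gradient (partition_Z m X) t /\<^sub>R Z)"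
      using assms(7) by (simp only: h_def Z_def)
    also have "\<dots> = (\<Sum>j=1..m. c j *\<^sub>R X j)"
      by (simp add: gradient_partition_Z scaleR_sum_right c_def divide_inverse mult_ac)
    finally show ?thesis .
  qed
  \<comment> \<open>\<open>ln (c j)\<close> is affine in \<open>X j\<close>, so the sum depends only
    on the total mass \<open>h\<close> and the first moment \<theta> of \<open>c\<close>.\<close>
  have entropy: "(\<Sum>j=1..m. c j * ln (c j)) = h * ln h - h * ln Z + t \<bullet> \<theta>"
  proof -
    have "ln (c j) = (ln h - ln Z) + t \<bullet> X j" for j
      using \<open>h > 0\<close> \<open>Z > 0\<close> by (simp add: c_def ln_mult ln_div)
    then have "(\<Sum>j=1..m. c j * ln (c j)) = (\<Sum>j=1..m. c j) * (ln h - ln Z) + (\<Sum>j=1..m. c j * (t \<bullet> X j))"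
      by (simp only: distrib_left sum.distrib sum_distrib_right)
    also have "\<dots> = h * (ln h - ln Z) + t \<bullet> \<theta>"
      unfolding sum_c by (simp add: \<theta> inner_sum_right)
    finally show ?thesis by (simp add: algebra_simps)
  qed

  \<comment> \<open>Approximation of the ray by monoid points with controlled coefficients\<close>
  have k\<theta>: "real k *\<^sub>R \<theta> = (\<Sum>j=1..m. (real k * c j) *\<^sub>R X j)" for k
    by (simp add: \<theta> scaleR_sum_right)
  define D where "D = (\<Sum>j=1..m. norm (X j))"
  have "\<exists>z. z \<in> monoid_J m X \<and> norm (real k *\<^sub>R \<theta> - z) \<le> D \<and>
      near_mult m X (real k *\<^sub>R \<theta>) = word_mult m X z" for k
  proof -
    have "infdist (real k *\<^sub>R \<theta>) (monoid_J m X) \<le> D"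
      unfolding k\<theta> D_def using c_pos by (intro infdist_monoid_J_le) (simp add: less_imp_le)
    then show ?thesis by (metis near_mult_attained[OF int])
  qed
  then obtain z where z: "\<And>k. z k \<in> monoid_J m X" "\<And>k. norm (real k *\<^sub>R \<theta> - z k) \<le> D"
    and near: "\<And>k. near_mult m X (real k *\<^sub>R \<theta>) = word_mult m X (z k)" by metis
  have z_lim: "(\<lambda>k. z k /\<^sub>R real k) \<longlonglongrightarrow> \<theta>"
    by (rule tendsto_divide_of_bounded_diff[of _ _ D]) (metis z(2) norm_minus_commute)

  \<comment> \<open>The radius is \<open>D + D\<close> because both \<open>z k\<close> and the
    rounded combination lie within \<open>D\<close> of
    \<open>real k *\<^sub>R \<theta>\<close>.\<close>
  obtain A where A: "\<And>b :: nat \<Rightarrow> int. norm (\<Sum>j=1..m. of_int (b j) *\<^sub>R X j) \<le> D + D \<Longrightarrow>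
      \<exists>a. (\<Sum>j=1..m. of_int (a j) *\<^sub>R X j) = (\<Sum>j=1..m. of_int (b j) *\<^sub>R X j) \<and> (\<forall>j\<in>{1..m}. \<bar>a j\<bar> \<le> A)"
    by (rule bounded_int_coefficients[OF int, of "D + D"]) blast
  \<comment> \<open>In the bound, \<open>A\<close> accounts for the bounded correction vector and
    \<open>1\<close> for the rounding.\<close>
  have "\<exists>v :: nat \<Rightarrow> int. z k = (\<Sum>j=1..m. of_int (v j) *\<^sub>R X j) \<and>
      (\<forall>j\<in>{1..m}. \<bar>of_int (v j) - real k * c j\<bar> \<le> of_int A + 1)" for k
  proof -
    let ?q = "\<lambda>j. \<lfloor>real k * c j\<rfloor>"
    obtain n :: "nat \<Rightarrow> nat" where n: "z k = (\<Sum>j=1..m. of_int (int (n j)) *\<^sub>R X j)"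
      using z(1) monoid_J_int_combination by blast
    define b where "b j = int (n j) - ?q j" for j
    have b: "(\<Sum>j=1..m. of_int (b j) *\<^sub>R X j) = z k - (\<Sum>j=1..m. of_int (?q j) *\<^sub>R X j)"
      by (simp add: b_def n scaleR_diff_left sum_subtractf)
    have "norm (real k *\<^sub>R \<theta> - (\<Sum>j=1..m. of_int (?q j) *\<^sub>R X j)) \<le> D"
      unfolding k\<theta> D_def by (rule norm_floor_combination)
    then have "norm (\<Sum>j=1..m. of_int (b j) *\<^sub>R X j) \<le> D + D"
      unfolding b using z(2)[of k] by (intro norm_diff_triangle_le) (simp_all only: norm_minus_commute)
    then obtain a where a: "(\<Sum>j=1..m. of_int (a j) *\<^sub>R X j) = (\<Sum>j=1..m. of_int (b j) *\<^sub>R X j)"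
      "\<forall>j\<in>{1..m}. \<bar>a j\<bar> \<le> A" using A by blast
    show ?thesis
    proof (intro exI conjI ballI)
      have "z k = (\<Sum>j=1..m. of_int (?q j) *\<^sub>R X j) + (\<Sum>j=1..m. of_int (a j) *\<^sub>R X j)"
        unfolding a(1) b by simp
      then show "z k = (\<Sum>j=1..m. of_int (?q j + a j) *\<^sub>R X j)"
        by (simp add: scaleR_add_left sum.distrib)
      fix j assume "j \<in> {1..m}"
      then have "\<bar>real_of_int (a j)\<bar> \<le> of_int A" using a(2) by (metis of_int_abs of_int_le_iff)
      then show "\<bar>of_int (?q j + a j) - real k * c j\<bar> \<le> of_int A + 1" by linarith
    qed
  qed
  then obtain v :: "nat \<Rightarrow> nat \<Rightarrow> int" where v: "\<And>k. z k = (\<Sum>j=1..m. of_int (v k j) *\<^sub>R X j)"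
    "\<And>k j. j \<in> {1..m} \<Longrightarrow> \<bar>of_int (v k j) - real k * c j\<bar> \<le> of_int A + 1" by metis
  define u where "u j k = nat (v k j)" for j k \<comment> \<open>truncates to \<open>0\<close> only for small \<open>k\<close>, see \<open>z_u\<close>\<close>
  have u_lim: "(\<lambda>k. real (u j k) / k) \<longlonglongrightarrow> c j" if "j \<in> {1..m}" for j
  proof -
    have "norm (real (u j k) - real k *\<^sub>R c j) \<le> of_int A + 1" for k
    proof -
      \<comment> \<open>Truncating a negative \<open>v k j\<close> to \<open>0\<close> moves it
        towards the nonnegative target, so the bound survives.\<close>
      have "real k * c j \<ge> 0" using c_pos by (simp add: less_imp_le)
      then show ?thesis using v(2)[OF that, of k] by (cases "v k j \<ge> 0") (auto simp: u_def)
    qed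
    from tendsto_divide_of_bounded_diff[OF this] show ?thesis by (simp add: divide_inverse mult.commute)
  qed
  have z_u: "\<forall>\<^sub>F k in sequentially. z k = (\<Sum>j=1..m. real (u j k) *\<^sub>R X j)"
  proof -
    \<comment> \<open>Since each \<open>c j\<close> is positive, all \<open>u j k\<close> are
      eventually positive, which excludes truncation.\<close>
    have "\<forall>\<^sub>F k in sequentially. \<forall>j\<in>{1..m}. real (u j k) / k > 0"
      by (intro eventually_ball_finite ballI order_tendstoD(1)[OF u_lim c_pos]) simp_all
    then show ?thesis
    proof eventually_elim
      case (elim k)
      have "real_of_int (v k j) = real (u j k)" if "j \<in> {1..m}" for j
        using bspec[OF elim that] by (cases "v k j \<ge> 0") (auto simp: u_def)
      then show ?case unfolding v(1) by (intro sum.cong) auto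
    qed
  qed

  \<comment> \<open>Squeezing the growth sequence\<close>
  let ?low = "\<lambda>k. ln (fact (\<Sum>j=1..m. u j k) / (\<Prod>j=1..m. fact (u j k))) / real k"
  \<comment> \<open>The upper bound is evaluated at \<open>z k\<close> rather than
    \<open>real k *\<^sub>R \<theta>\<close>; it is linear in \<open>z k /\<^sub>R real k\<close>,
    so \<open>z_lim\<close> yields its limit.\<close>
  let ?up = "\<lambda>k. (\<eta> \<bullet> (z k /\<^sub>R real k)) * ln Z - t \<bullet> (z k /\<^sub>R real k)"
  let ?L = "h * ln Z - t \<bullet> \<theta>"
  have low_lim: "?low \<longlonglongrightarrow> ?L"
  proof -
    have "?low \<longlonglongrightarrow> (\<Sum>j=1..m. c j) * ln (\<Sum>j=1..m. c j) - (\<Sum>j=1..m. c j * ln (c j))"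
      by (rule ln_multinomial_asymp) (use u_lim c_pos assms(1) in auto)
    then show ?thesis by (simp only: sum_c entropy) simp
  qed
  have up_lim: "?up \<longlonglongrightarrow> ?L"
    unfolding h_def inner_commute[of \<theta> \<eta>] by (intro tendsto_intros z_lim)
  have low: "0 < fact (\<Sum>j=1..m. u j k) / (\<Prod>j=1..m. fact (u j k) :: real)" for k
    by (simp add: prod_pos)
  have low_le: "\<forall>\<^sub>F k in sequentially. fact (\<Sum>j=1..m. u j k) / (\<Prod>j=1..m. fact (u j k))
      \<le> real (word_mult m X (z k))"
    using z_u by eventually_elim (simp only: multinomial_le_word_mult[OF cop])
  have "growth_seq m X \<theta> \<longlonglongrightarrow> ?L"
  proof (rule tendsto_sandwich[OF _ _ low_lim up_lim])
    show "\<forall>\<^sub>F k in sequentially. ?low k \<le> growth_seq m X \<theta> k"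
      using low_le
    proof eventually_elim
      case (elim k)
      then show ?case unfolding growth_seq_def near using low[of k]
        by (intro divide_right_mono ln_mono) auto
    qed
    show "\<forall>\<^sub>F k in sequentially. growth_seq m X \<theta> k \<le> ?up k"
      using low_le
    proof eventually_elim
      case (elim k)
      \<comment> \<open>Taking logarithms requires a positive multiplicity; it is read off from the
        multinomial lower bound, which is why \<open>low_le\<close> enters here as well.\<close>
      have pos: "real (word_mult m X (z k)) > 0" using elim low[of k] by linarith
      obtain n where n: "\<eta> \<bullet> z k = real n" using monoid_J_inner_nat[OF cop z(1)] .
      have "ln (word_mult m X (z k) * exp (t \<bullet> z k)) \<le> ln (Z ^ n)"
        using word_mult_le[OF cop n, of t] pos by (intro ln_mono) (auto simp: Z_def)
      then have "ln (real (word_mult m X (z k))) \<le> (\<eta> \<bullet> z k) * ln Z - t \<bullet> z k"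
        using pos \<open>Z > 0\<close> by (simp add: ln_mult ln_realpow n)
      then have "ln (real (word_mult m X (z k))) / k \<le> ((\<eta> \<bullet> z k) * ln Z - t \<bullet> z k) / k"
        by (rule divide_right_mono) simp
      then show ?case unfolding growth_seq_def near
        by (simp add: divide_inverse algebra_simps)
    qed
  qed
  then show ?thesis
    unfolding dir_growth_def h_def Z_def by (auto simp: convergent_def dest: limI)
qed

end
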